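(* The following statements hold. (B1) It is impossible to walk to infinity on primes in base $3$ by appending a single digit at a time to the right. (B2) It is impossible to walk to infinity on primes in base $4$ by appending a single digit at a time to the right. (B3) It is impossible to walk to infinity on primes in base $5$ by appending a single digit at a time to the right. (B4) It is impossible to walk to infinity on primes in base $6$ by appending a single digit at a time to the right. That is, for each $b \in \{3,4,5,6\}$ there is no infinite sequence of primes $p_0, p_1, p_2, \ldots$ such that for every $i \ge 0$ one has $p_{i+1} = b\,p_i + d_i$ for some digit $d_i \in \{0, 1, \ldots, b-1\}$.
   Context: A walk to infinity on primes in base $b$, appending a single digit at a time to the right, is an infinite sequence of primes, starting from an arbitrary prime, in which each term is obtained from the previous one by appending one base-$b$ digit on the right, i.e. by passing from $p$ to $bp+d$ with $d \in \{0,\ldots,b-1\}$. *)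

theory Defs
  imports "HOL-Computational_Algebra.Primes"
begin

definition append_digit :: "nat \<Rightarrow> nat \<Rightarrow> nat \<Rightarrow> nat" where
  "append_digit b p d = b * p + d"

(* The starting prime p 0 is arbitrary, and the appended digit may be 0. *)
definition walk_to_infinity_on_primes :: "nat \<Rightarrow> (nat \<Rightarrow> nat) \<Rightarrow> bool" where
  "walk_to_infinity_on_primes b p \<longleftrightarrow>
     (\<forall>i. prime (p i)) \<and> (\<forall>i. \<exists>d\<in>{0..<b}. p (Suc i) = append_digit b (p i) d)"

end

theory Submission
  imports Defs "HOL-Number_Theory.Residues"
begin

text \<open>
  If the appended digit is eventually a constant \<open>d\<close>, then \<open>(b - 1) p + d\<close> is multiplied by \<open>b\<close> in
  each step. Starting from a term \<open>q > b\<close>, Fermat's little theorem shows that \<open>q\<close> divides the term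
  \<open>q - 1\<close> steps later, which is therefore not prime.

  For \<open>b \<in> {3, 4, 5, 6}\<close> the digit is eventually constant: divisibility by the prime factors of
  \<open>b\<close> and by 2 leaves at most two possible digits. In base 5 the residue modulo 3 determines the
  digit and is preserved. In bases 4 and 6 the digit \<open>b - 1\<close> preserves the residue modulo \<open>b - 1\<close>
  and the digit 1 increases it by 1, so the latter can only occur finitely often before the residue
  becomes 0.
\<close>

lemma walk_prime: "walk_to_infinity_on_primes b p \<Longrightarrow> prime (p i)"
  by (simp add: walk_to_infinity_on_primes_def)

lemma walk_step:
  assumes "walk_to_infinity_on_primes b p"
  obtains d where "d < b" "p (Suc i) = b * p i + d"
proof -
  have "\<exists>d\<in>{0..<b}. p (Suc i) = append_digit b (p i) d"
    using assms by (simp add: walk_to_infinity_on_primes_def)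
  then show thesis
    by (auto simp: append_digit_def intro: that)
qed

lemma walk_strict_mono:
  assumes w: "walk_to_infinity_on_primes b p" and b: "b \<ge> 2"
  shows "strict_mono p"
proof (unfold strict_mono_Suc_iff, rule allI)
  fix i
  obtain d where d: "p (Suc i) = b * p i + d"
    using walk_step[OF w] by blast
  have "0 < p i"
    using walk_prime[OF w] prime_gt_0_nat by blast
  then have "p i < 2 * p i"
    by simp
  also have "\<dots> \<le> p (Suc i)"
    using b d by (simp add: trans_le_add1)
  finally show "p i < p (Suc i)" .
qed

lemma walk_tail:
  "walk_to_infinity_on_primes b p \<Longrightarrow> walk_to_infinity_on_primes b (\<lambda>i. p (i + k))"
  by (simp add: walk_to_infinity_on_primes_def)

text \<open>Allows replacing a walk by a tail avoiding all small primes. A strictly increasing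
  sequence of naturals satisfies \<open>i \<le> p i\<close>, so dropping \<open>Suc n\<close> terms
  suffices.\<close>

lemma walk_large:
  assumes w: "walk_to_infinity_on_primes b p" and b: "b \<ge> 2"
  obtains p' where "walk_to_infinity_on_primes b p'" "\<And>i. n < p' i"
proof
  show "walk_to_infinity_on_primes b (\<lambda>i. p (i + Suc n))"
    using walk_tail[OF w] .
  show "n < p (i + Suc n)" for i
    using strict_mono_imp_increasing[OF walk_strict_mono[OF w b], of "i + Suc n"] by simp
qed

lemma no_walk_eventually_constant_digit:
  assumes w: "walk_to_infinity_on_primes b p" and b: "b \<ge> 2"
    and const: "\<And>i. N \<le> i \<Longrightarrow> p (Suc i) = b * p i + d"
  shows False
proof -
  obtain c where c: "b = Suc c" "c > 0"
    using b by (cases b) auto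
  have mono: "strict_mono p"
    using walk_strict_mono[OF w b] .
  \<comment> \<open>The shift by \<open>N\<close> puts all later steps in the constant regime; the
    shift by \<open>Suc b\<close> forces \<open>b < q\<close>, so that \<open>q\<close> divides
    neither \<open>b\<close> nor \<open>c = b - 1\<close>.\<close>
  define M where "M = N + Suc b"
  define q where "q = p M"
  have q: "prime q"
    using walk_prime[OF w] by (simp add: q_def)
  have "b < q"
    using strict_mono_imp_increasing[OF mono, of M] by (simp add: M_def q_def)
  then have nb: "\<not> q dvd b" and nc: "\<not> q dvd c"
    using c by (auto dest: dvd_imp_le)
  \<comment> \<open>The map \<open>x \<mapsto> b * x + d\<close> becomes multiplication by
    \<open>b\<close> in the coordinate \<open>c * x + d\<close>, because
    \<open>c * d + d = b * d\<close>.\<close>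
  have closed: "c * p (M + n) + d = b ^ n * (c * q + d)" for n
  proof (induction n)
    case (Suc n)
    have "c * p (M + Suc n) + d = b * (c * p (M + n) + d)"
      using const[of "M + n"] c by (simp add: M_def algebra_simps)
    then show ?case
      using Suc by simp
  qed (simp add: q_def)
  have "[b ^ (q - 1) * (c * q + d) = 1 * (0 + d)] (mod q)"
    by (intro cong_mult cong_add fermat_theorem q nb cong_refl) (simp add: cong_def)
  then have "[c * p (M + (q - 1)) + d = 0 + d] (mod q)"
    by (simp only: closed mult_1)
  then have "q dvd c * p (M + (q - 1))"
    by (simp only: cong_add_rcancel_nat cong_0_iff)
  then have "q dvd p (M + (q - 1))"
    using q nc prime_dvd_mult_iff by blast
  then have "p M = p (M + (q - 1))"
    using q walk_prime[OF w] primes_dvd_imp_eq q_def by blast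
  \<comment> \<open>Strictness needs \<open>q - 1 > 0\<close>, which holds as \<open>q\<close> is
    prime.\<close>
  moreover have "p M < p (M + (q - 1))"
    using mono prime_gt_1_nat[OF q] by (simp add: strict_mono_less)
  ultimately show False
    by simp
qed

text \<open>Take \<open>N\<close> where \<open>f\<close> attains its maximum; monotonicity keeps
  every later value at that maximum.\<close>

lemma bounded_mono_eventually_constant:
  fixes f :: "nat \<Rightarrow> nat"
  assumes mono: "\<And>i. f i \<le> f (Suc i)" and bound: "\<And>i. f i < m"
  obtains N where "\<And>i. N \<le> i \<Longrightarrow> f i = f N"
proof -
  obtain N where N: "\<And>i. f i \<le> f N"
    using ex_has_greatest_nat[of "\<lambda>_. True" 0 f m] bound by blast
  show thesis
    by (rule that, rule order_antisym[OF N lift_Suc_mono_le[of f, OF mono]])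
qed

text \<open>Treats bases 4 and 6 together. As \<open>Suc c\<close> is 1 modulo \<open>c\<close>,
  appending a digit adds that digit to the residue modulo \<open>c\<close>.\<close>

lemma no_walk_digits_1_or_last:
  assumes w: "walk_to_infinity_on_primes (Suc c) p" and c: "c > 0"
    and nz: "\<And>i. p i mod c \<noteq> 0"
    and digit: "\<And>i. p (Suc i) = Suc c * p i + 1 \<or> p (Suc i) = Suc c * p i + c"
  shows False
proof -
  have step: "p (Suc i) = Suc c * p i + c \<and> p (Suc i) mod c = p i mod c \<or>
      p (Suc i) mod c = Suc (p i mod c)" for i
    using digit[of i]
  proof
    assume one: "p (Suc i) = Suc c * p i + 1"
    have "p (Suc i) mod c = (Suc (p i) + c * p i) mod c"
      by (simp add: one add.commute)
    also have "\<dots> = Suc (p i) mod c"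
      by (rule mod_mult_self2)
    \<comment> \<open>The residue cannot wrap around from \<open>c - 1\<close> to 0, since
      \<open>nz\<close> forbids residue 0.\<close>
    finally show ?thesis
      using nz[of "Suc i"] by (simp add: mod_Suc split: if_splits)
  next
    assume last: "p (Suc i) = Suc c * p i + c"
    have "p (Suc i) mod c = (p i + c * Suc (p i)) mod c"
      by (simp add: last algebra_simps)
    also have "\<dots> = p i mod c"
      by (rule mod_mult_self2)
    finally show ?thesis
      using last by simp
  qed
  have "p i mod c \<le> p (Suc i) mod c" for i
    using step[of i] by linarith
  then obtain N where N: "\<And>i. N \<le> i \<Longrightarrow> p i mod c = p N mod c"
    using bounded_mono_eventually_constant[of "\<lambda>i. p i mod c" c] c by auto
  have "p (Suc i) = Suc c * p i + c" if "N \<le> i" for i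
    using step[of i] N[of i] N[of "Suc i"] that by linarith
  then show False
    using no_walk_eventually_constant_digit[OF w, of N c] c by simp
qed

lemma prime_mod_neq_0:
  fixes n k :: nat
  assumes "prime n" "2 \<le> k" "k < n"
  shows "n mod k \<noteq> 0"
proof
  assume "n mod k = 0"
  then have "k dvd n"
    by (simp add: mod_0_imp_dvd)
  then show False
    using assms by (auto simp: prime_nat_iff)
qed

lemma no_walk_base_3: "\<not> walk_to_infinity_on_primes 3 p"
proof
  assume "walk_to_infinity_on_primes 3 p"
  \<comment> \<open>The bound 6 exceeds each modulus 2, 3, 5 used below, so no term is divisible by
    any of them.\<close>
  then obtain p where w: "walk_to_infinity_on_primes 3 p" and large: "\<And>i. 6 < p i"
    using walk_large[of 3 p 6] by auto
  note nz = prime_mod_neq_0[OF walk_prime[OF w] _ less_trans[OF _ large]]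
  have "p (Suc i) = 3 * p i + 2" for i
  proof -
    obtain d where d: "d < 3" "p (Suc i) = 3 * p i + d"
      using walk_step[OF w] .
    have "d mod 2 = 0"
      using nz[of 2 i] nz[of 2 "Suc i"] d by simp presburger
    moreover have "d \<noteq> 0"
      using nz[of 3 "Suc i"] d by auto
    ultimately have "d = 2"
      using d by presburger
    then show ?thesis
      using d by simp
  qed
  then show False
    using no_walk_eventually_constant_digit[OF w, of 0 2] by simp
qed

lemma no_walk_base_4: "\<not> walk_to_infinity_on_primes 4 p"
proof
  assume "walk_to_infinity_on_primes 4 p"
  then obtain p where w: "walk_to_infinity_on_primes 4 p" and large: "\<And>i. 6 < p i"
    using walk_large[of 4 p 6] by auto
  note nz = prime_mod_neq_0[OF walk_prime[OF w] _ less_trans[OF _ large]]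
  have "p (Suc i) = Suc 3 * p i + 1 \<or> p (Suc i) = Suc 3 * p i + 3" for i
  proof -
    obtain d where d: "d < 4" "p (Suc i) = 4 * p i + d"
      using walk_step[OF w] .
    have "d mod 2 \<noteq> 0"
      using nz[of 2 "Suc i"] d by simp presburger
    then have "d = 1 \<or> d = 3"
      using d(1) by presburger
    then show ?thesis
      using d(2) by auto
  qed
  moreover have "p i mod 3 \<noteq> 0" for i
    using nz[of 3 i] by simp
  ultimately show False
    using no_walk_digits_1_or_last[of 3 p] w by simp
qed

lemma no_walk_base_5: "\<not> walk_to_infinity_on_primes 5 p"
proof
  assume "walk_to_infinity_on_primes 5 p"
  then obtain p where w: "walk_to_infinity_on_primes 5 p" and large: "\<And>i. 6 < p i"
    using walk_large[of 5 p 6] by auto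
  note nz = prime_mod_neq_0[OF walk_prime[OF w] _ less_trans[OF _ large]]
  \<comment> \<open>Modulo 3 the new term is \<open>2 * p i + d\<close>. For residue 1 the digit 4
    would give 0, for residue 2 the digit 2 would; hence \<open>d\<close> is twice the residue, and
    the residue is kept because \<open>2 * r + 2 * r = 4 * r\<close> is \<open>r\<close> modulo
    3.\<close>
  have step: "p (Suc i) = 5 * p i + 2 * (p i mod 3) \<and> p (Suc i) mod 3 = p i mod 3" for i
  proof -
    obtain d where d: "d < 5" "p (Suc i) = 5 * p i + d"
      using walk_step[OF w] .
    have "d mod 2 = 0"
      using nz[of 2 i] nz[of 2 "Suc i"] d by simp presburger
    moreover have "d \<noteq> 0"
      using nz[of 5 "Suc i"] d by auto
    ultimately have "d = 2 \<or> d = 4"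
      using d(1) by presburger
    then show ?thesis
      using nz[of 3 i] nz[of 3 "Suc i"] d(2) by (elim disjE; simp; presburger)
  qed
  have "p i mod 3 = p 0 mod 3" for i
    by (induction i) (simp, metis step)
  then have "p (Suc i) = 5 * p i + 2 * (p 0 mod 3)" for i
    using step[of i] by simp
  then show False
    using no_walk_eventually_constant_digit[OF w, of 0] by simp
qed

lemma no_walk_base_6: "\<not> walk_to_infinity_on_primes 6 p"
proof
  assume "walk_to_infinity_on_primes 6 p"
  then obtain p where w: "walk_to_infinity_on_primes 6 p" and large: "\<And>i. 6 < p i"
    using walk_large[of 6 p 6] by auto
  note nz = prime_mod_neq_0[OF walk_prime[OF w] _ less_trans[OF _ large]]
  have "p (Suc i) = Suc 5 * p i + 1 \<or> p (Suc i) = Suc 5 * p i + 5" for i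
  proof -
    obtain d where d: "d < 6" "p (Suc i) = 6 * p i + d"
      using walk_step[OF w] .
    have "d mod 2 \<noteq> 0" "d mod 3 \<noteq> 0"
      using nz[of 2 "Suc i"] nz[of 3 "Suc i"] d by (simp; presburger)+
    then have "d = 1 \<or> d = 5"
      using d(1) by presburger
    then show ?thesis
      using d(2) by auto
  qed
  moreover have "p i mod 5 \<noteq> 0" for i
    using nz[of 5 i] by simp
  ultimately show False
    using no_walk_digits_1_or_last[of 5 p] w by simp
qed

theorem lemmaA1:
  shows "(\<nexists>p. walk_to_infinity_on_primes 3 p) \<and>
         (\<nexists>p. walk_to_infinity_on_primes 4 p) \<and>
         (\<nexists>p. walk_to_infinity_on_primes 5 p) \<and>
         (\<nexists>p. walk_to_infinity_on_primes 6 p)"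
  using no_walk_base_3 no_walk_base_4 no_walk_base_5 no_walk_base_6 by blast

end
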